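(* Let $T\ge 2$ be an even integer. Suppose the set $\mathcal{O}$ of non-metered buses can be partitioned into subsets $\{\bar{\mathcal{O}}_k\}_{k=1}^{\lceil T/2\rceil}$ such that, for each $k$ independently, the set $\bar{\mathcal{O}}_k$ can be perfectly matched to $\mathcal{M}$ on $\mathcal{G}$. Then the Jacobian matrix $\mathbf{J}(\{\mathbf{v}_t\})$ of the Probing-to-Learn task with non-phasor data over $T$ probing slots has full generic rank.
   Context: Grid. A feeder is a finite graph $\mathcal{G}=(\mathcal{N}^+,\mathcal{L})$ with bus set $\mathcal{N}^+=\{0,\dots,N\}$ and line set $\mathcal{L}$. Its bus admittance matrix is $\mathbf{Y}=\mathbf{G}+j\mathbf{B}$ with $\mathbf{G},\mathbf{B}$ real; for $n\ne m$ the entries $G_{nm},B_{nm}$ are non-zero only on lines, and the sparsity pattern of $\mathbf{G}$ is taken to be: $G_{nm}\neq 0$ iff $n=m$ or $(n,m)\in\mathcal{L}$. The buses are partitioned as $\mathcal{N}^+=\mathcal{M}\cup\mathcal{O}$ (disjoint), $\mathcal{M}$ being the metered (probed) and $\mathcal{O}$ the non-metered buses; $M=|\mathcal{M}|$, $O=|\mathcal{O}|$, $N+1=M+O$. State and power flow functions. With voltage phasors $v_n=v_{r,n}+jv_{i,n}$, the state is $\mathbf{v}=[v_{r,0},\dots,v_{r,N},v_{i,0},\dots,v_{i,N}]^\top\in\mathbb{R}^{2(N+1)}$. As functions of $\mathbf{v}$: the squared voltage magnitude $u_n(\mathbf{v})=v_{r,n}^2+v_{i,n}^2$ and the power injections $p_n(\mathbf{v})=v_{r,n}\sum_m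 (v_{r,m}G_{nm}-v_{i,m}B_{nm})+v_{i,n}\sum_m (v_{r,m}B_{nm}+v_{i,m}G_{nm})$, $q_n(\mathbf{v})=v_{i,n}\sum_m (v_{r,m}G_{nm}-v_{i,m}B_{nm})-v_{r,n}\sum_m (v_{r,m}B_{nm}+v_{i,m}G_{nm})$. Probing-to-Learn task with non-phasor data. The unknowns are the states $\mathbf{v}_1,\dots,\mathbf{v}_T$. The equations are the metering equations, prescribing $u_n(\mathbf{v}_t),p_n(\mathbf{v}_t),q_n(\mathbf{v}_t)$ for all $n\in\mathcal{M}$, $t=1,\dots,T$, and the coupling equations $p_n(\mathbf{v}_t)=p_n(\mathbf{v}_{t+1})$, $q_n(\mathbf{v}_t)=q_n(\mathbf{v}_{t+1})$ for all $n\in\mathcal{O}$, $t=1,\dots,T-1$. Jacobian. $\mathbf{J}(\{\mathbf{v}_t\})$ is the $(3MT+2O(T-1))\times 2(N+1)T$ Jacobian of these equations. For each $t$ it has the $3M$ metering rows $\mathbf{J}_{\mathcal{M}}(\mathbf{v}_t)$ (gradients of $u_n,p_n,q_n$, $n\in\mathcal{M}$) in the columns of $\mathbf{v}_t$ and zeros elsewhere. For each $t\le T-1$ it has the $2O$ coupling rows equal to $\mathbf{J}_{\mathcal{O}}(\mathbf{v}_t)$ (gradients of $p_n,q_n$, $n\in\mathcal{O}$) in the columns of $\mathbf{v}_t$, $-\mathbf{J}_{\mathcal{O}}(\mathbf{v}_{t+1})$ in the columns of $\mathbf{v}_{t+1}$, and zeros elsewhere. Sparsity pattern: the gradient row of $u_n$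 has the pattern of row $n$ of $[\mathbf{I}_{N+1}~\mathbf{I}_{N+1}]$, and the gradient row of $p_n$ or of $q_n$ has the pattern of row $n$ of $[\mathbf{G}~\mathbf{G}]$. Generic rank. The generic rank of a matrix is the maximum rank attained when its non-zero entries (the entries in its sparsity pattern) are allowed to take arbitrary real values, independently. A matrix with at least as many rows as columns has full generic rank (is generically full rank) if its generic rank equals its number of columns. Matching. A set $A$ is perfectly matched to a set $B$ on a graph if there is an injective map $A\to B$ sending each element of $A$ to a node adjacent to it. *)

theory Defs
  imports
    "HOL-Analysis.Analysis"
    "HOL-Library.Disjoint_Sets"
    "Jordan_Normal_Form.DL_Rank"
begin

unbundle no vec_syntax

section \<open>Feeder and power flow functions\<close>

text \<open>The buses are \<open>0, \<dots>, N\<close> and a line is an unordered pair of distinct buses.\<close>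

definition feeder :: "nat \<Rightarrow> nat set set \<Rightarrow> complex mat \<Rightarrow> bool" where
  "feeder N L Y \<longleftrightarrow>
     L \<subseteq> {{n, m} | n m. n \<le> N \<and> m \<le> N \<and> n \<noteq> m} \<and>
     Y \<in> carrier_mat (N + 1) (N + 1) \<and>
     (\<forall>n\<le>N. \<forall>m\<le>N. n \<noteq> m \<and> {n, m} \<notin> L \<longrightarrow> Y $$ (n, m) = 0) \<and>
     (\<forall>n\<le>N. \<forall>m\<le>N. Re (Y $$ (n, m)) \<noteq> 0 \<longleftrightarrow> n = m \<or> {n, m} \<in> L)"

definition Gmat :: "complex mat \<Rightarrow> real mat" where "Gmat Y = map_mat Re Y"
definition Bmat :: "complex mat \<Rightarrow> real mat" where "Bmat Y = map_mat Im Y"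

text \<open>A state is a vector of dimension \<open>2 (N + 1)\<close>: real parts of the voltages of
  buses \<open>0, \<dots>, N\<close>, followed by the imaginary parts.\<close>

definition vre :: "nat \<Rightarrow> real vec \<Rightarrow> nat \<Rightarrow> real" where "vre N v n = v $ n"
definition vim :: "nat \<Rightarrow> real vec \<Rightarrow> nat \<Rightarrow> real" where "vim N v n = v $ (N + 1 + n)"

definition cur_re :: "nat \<Rightarrow> complex mat \<Rightarrow> nat \<Rightarrow> real vec \<Rightarrow> real" where
  "cur_re N Y n v = (\<Sum>m\<le>N. vre N v m * Gmat Y $$ (n, m) - vim N v m * Bmat Y $$ (n, m))"
definition cur_im :: "nat \<Rightarrow> complex mat \<Rightarrow> nat \<Rightarrow> real vec \<Rightarrow> real" where
  "cur_im N Y n v = (\<Sum>m\<le>N. vre N v m * Bmat Y $$ (n, m) + vim N v m * Gmat Y $$ (n, m))"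

definition usq :: "nat \<Rightarrow> nat \<Rightarrow> real vec \<Rightarrow> real" where
  "usq N n v = (vre N v n)\<^sup>2 + (vim N v n)\<^sup>2"
definition pinj :: "nat \<Rightarrow> complex mat \<Rightarrow> nat \<Rightarrow> real vec \<Rightarrow> real" where
  "pinj N Y n v = vre N v n * cur_re N Y n v + vim N v n * cur_im N Y n v"
definition qinj :: "nat \<Rightarrow> complex mat \<Rightarrow> nat \<Rightarrow> real vec \<Rightarrow> real" where
  "qinj N Y n v = vim N v n * cur_re N Y n v - vre N v n * cur_im N Y n v"

section \<open>Equations of the Probing-to-Learn task\<close>

datatype quantity = U nat | P nat | Q nat

fun qval :: "nat \<Rightarrow> complex mat \<Rightarrow> quantity \<Rightarrow> real vec \<Rightarrow> real" where
  "qval N Y (U n) = usq N n"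
| "qval N Y (P n) = pinj N Y n"
| "qval N Y (Q n) = qinj N Y n"

text \<open>\<open>Meter t x\<close> prescribes the value of \<open>x\<close> in slot \<open>t\<close>; \<open>Couple t x\<close>
  equates the values of \<open>x\<close> in slots \<open>t\<close> and \<open>t + 1\<close>. In \<open>eq_lhs\<close> the prescribed
  data are left out, as they are constants and do not enter the Jacobian.\<close>

datatype equation = Meter nat quantity | Couple nat quantity

fun eq_lhs :: "nat \<Rightarrow> complex mat \<Rightarrow> equation \<Rightarrow> (nat \<Rightarrow> real vec) \<Rightarrow> real" where
  "eq_lhs N Y (Meter t x) v = qval N Y x (v t)"
| "eq_lhs N Y (Couple t x) v = qval N Y x (v t) - qval N Y x (v (t + 1))"

definition ptl_equations :: "nat set \<Rightarrow> nat set \<Rightarrow> nat \<Rightarrow> equation list" where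
  "ptl_equations M Ob T =
     (let ms = sorted_list_of_set M; os = sorted_list_of_set Ob in
       concat (map (\<lambda>t. map (Meter t) (map U ms @ map P ms @ map Q ms)) [1..<T + 1]) @
       concat (map (\<lambda>t. map (Couple t) (map P os @ map Q os)) [1..<T]))"

section \<open>The Jacobian\<close>

text \<open>The unknowns \<open>v 1, \<dots>, v T\<close> are stacked: column \<open>c\<close> of the Jacobian is
  coordinate \<open>coord N c\<close> of the state in slot \<open>slot N c\<close>.\<close>

definition slot :: "nat \<Rightarrow> nat \<Rightarrow> nat" where "slot N c = c div (2 * (N + 1)) + 1"
definition coord :: "nat \<Rightarrow> nat \<Rightarrow> nat" where "coord N c = c mod (2 * (N + 1))"

definition partial_deriv ::
    "nat \<Rightarrow> ((nat \<Rightarrow> real vec) \<Rightarrow> real) \<Rightarrow> (nat \<Rightarrow> real vec) \<Rightarrow> nat \<Rightarrow> nat \<Rightarrow> real" where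
  "partial_deriv N F v t j =
     deriv (\<lambda>h. F (v(t := v t + h \<cdot>\<^sub>v unit_vec (2 * (N + 1)) j))) 0"

definition ptl_jacobian ::
    "nat \<Rightarrow> complex mat \<Rightarrow> nat set \<Rightarrow> nat set \<Rightarrow> nat \<Rightarrow> (nat \<Rightarrow> real vec) \<Rightarrow> real mat" where
  "ptl_jacobian N Y M Ob T v =
     mat (length (ptl_equations M Ob T)) (2 * (N + 1) * T)
       (\<lambda>(i, c). partial_deriv N (eq_lhs N Y (ptl_equations M Ob T ! i)) v (slot N c) (coord N c))"

section \<open>Sparsity pattern\<close>

text \<open>\<open>beside A\<close> is the block matrix \<open>[A A]\<close>.\<close>

definition beside :: "real mat \<Rightarrow> real mat" where
  "beside A = mat (dim_row A) (2 * dim_col A) (\<lambda>(i, j). A $$ (i, j mod dim_col A))"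

fun grad_pattern :: "nat \<Rightarrow> complex mat \<Rightarrow> quantity \<Rightarrow> nat set" where
  "grad_pattern N Y (U n) = {j. j < 2 * (N + 1) \<and> beside (1\<^sub>m (N + 1)) $$ (n, j) \<noteq> 0}"
| "grad_pattern N Y (P n) = {j. j < 2 * (N + 1) \<and> beside (Gmat Y) $$ (n, j) \<noteq> 0}"
| "grad_pattern N Y (Q n) = {j. j < 2 * (N + 1) \<and> beside (Gmat Y) $$ (n, j) \<noteq> 0}"

fun eq_pattern :: "nat \<Rightarrow> complex mat \<Rightarrow> equation \<Rightarrow> (nat \<times> nat) set" where
  "eq_pattern N Y (Meter t x) = {t} \<times> grad_pattern N Y x"
| "eq_pattern N Y (Couple t x) = {t, t + 1} \<times> grad_pattern N Y x"

definition ptl_pattern ::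
    "nat \<Rightarrow> complex mat \<Rightarrow> nat set \<Rightarrow> nat set \<Rightarrow> nat \<Rightarrow> (nat \<times> nat) set" where
  "ptl_pattern N Y M Ob T =
     {(i, c). i < length (ptl_equations M Ob T) \<and> c < 2 * (N + 1) * T \<and>
        (slot N c, coord N c) \<in> eq_pattern N Y (ptl_equations M Ob T ! i)}"

section \<open>Generic rank\<close>

text \<open>The entries of \<open>J\<close> at the positions in \<open>S\<close> vary freely and independently,
  all other entries are kept. This is the generic rank of \<open>J\<close> when \<open>S\<close> is a
  sparsity pattern of \<open>J\<close>, i.e. when the entries of \<open>J\<close> outside \<open>S\<close> vanish; see
  \<open>ptl_jacobian_outside_pattern\<close> below.\<close>

definition pattern_class :: "real mat \<Rightarrow> (nat \<times> nat) set \<Rightarrow> real mat set" where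
  "pattern_class J S =
     {A \<in> carrier_mat (dim_row J) (dim_col J).
        \<forall>i<dim_row J. \<forall>j<dim_col J. (i, j) \<notin> S \<longrightarrow> A $$ (i, j) = J $$ (i, j)}"

definition generic_rank :: "real mat \<Rightarrow> (nat \<times> nat) set \<Rightarrow> nat" where
  "generic_rank J S = Max (vec_space.rank (dim_row J) ` pattern_class J S)"

definition full_generic_rank :: "real mat \<Rightarrow> (nat \<times> nat) set \<Rightarrow> bool" where
  "full_generic_rank J S \<longleftrightarrow> dim_col J \<le> dim_row J \<and> generic_rank J S = dim_col J"

section \<open>Matching\<close>

definition perfectly_matched :: "nat set set \<Rightarrow> nat set \<Rightarrow> nat set \<Rightarrow> bool" where
  "perfectly_matched L A B \<longleftrightarrow>
     (\<exists>f. inj_on f A \<and> (\<forall>a\<in>A. f a \<in> B \<and> {a, f a} \<in> L))"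

section \<open>Shape of the Jacobian\<close>

lemma length_ptl_equations:
  assumes "finite M" "finite Ob"
  shows "length (ptl_equations M Ob T) = 3 * card M * T + 2 * card Ob * (T - 1)"
proof -
  have len: "length (concat (map (\<lambda>t. map (f t) xs) [a..<b])) = (b - a) * length xs"
    for f :: "nat \<Rightarrow> quantity \<Rightarrow> equation" and xs a b
    by (simp add: length_concat o_def sum_list_triv)
  show ?thesis
    unfolding ptl_equations_def Let_def length_append len
    using assms by (simp add: algebra_simps)
qed

lemma set_ptl_equations:
  assumes "finite M" "finite Ob"
  shows "set (ptl_equations M Ob T) =
    {Meter t x | t x. t \<in> {1..T} \<and> x \<in> U ` M \<union> P ` M \<union> Q ` M} \<union>
    {Couple t x | t x. t \<in> {1..<T} \<and> x \<in> P ` Ob \<union> Q ` Ob}"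
  using assms by (force simp: ptl_equations_def Let_def image_iff)

fun qbus :: "quantity \<Rightarrow> nat" where
  "qbus (U n) = n" | "qbus (P n) = n" | "qbus (Q n) = n"

lemma beside_index:
  assumes "A \<in> carrier_mat (N + 1) (N + 1)" "n \<le> N" "j < 2 * (N + 1)"
  shows "beside A $$ (n, j) = A $$ (n, j mod (N + 1))"
  using assms by (auto simp: beside_def)

lemma grad_pattern_iff:
  assumes "feeder N L Y" "qbus x \<le> N" "j < 2 * (N + 1)"
  shows "j \<in> grad_pattern N Y x \<longleftrightarrow>
    (case x of U n \<Rightarrow> j mod (N + 1) = n | _ \<Rightarrow> Gmat Y $$ (qbus x, j mod (N + 1)) \<noteq> 0)"
proof -
  have Y: "Gmat Y \<in> carrier_mat (N + 1) (N + 1)"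
    using assms(1) by (auto simp: feeder_def Gmat_def)
  have I: "1\<^sub>m (N + 1) \<in> carrier_mat (N + 1) (N + 1)" by simp
  have "j mod (N + 1) < N + 1" by simp
  then show ?thesis
    using assms(2,3) beside_index[OF Y _ assms(3)] beside_index[OF I _ assms(3)]
    by (cases x) auto
qed

lemma qval_outside_pattern:
  assumes F: "feeder N L Y" and n: "qbus x \<le> N" and j: "j < 2 * (N + 1)"
    and nj: "j \<notin> grad_pattern N Y x" and w: "w \<in> carrier_vec (2 * (N + 1))"
  shows "qval N Y x (w + h \<cdot>\<^sub>v unit_vec (2 * (N + 1)) j) = qval N Y x w"
proof -
  let ?w = "w + h \<cdot>\<^sub>v unit_vec (2 * (N + 1)) j"
  define b where "b = j mod (N + 1)"
  have jb: "j = b \<or> j = N + 1 + b"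
    using j unfolding b_def by (cases "j < N + 1") (auto simp: mod_if)
  have bN: "b \<le> N" unfolding b_def using mod_less_divisor[of "N + 1" j] by linarith
  have re: "vre N ?w m = vre N w m" and im: "vim N ?w m = vim N w m" if "m \<le> N" "m \<noteq> b" for m
    using that w jb bN by (auto simp: vre_def vim_def)
  have G: "Gmat Y $$ (m, b) = Re (Y $$ (m, b))" if "m \<le> N" for m
    using that F bN by (auto simp: Gmat_def feeder_def)
  have Z: "m \<noteq> b \<and> Y $$ (m, b) = 0" if "m \<le> N" "Re (Y $$ (m, b)) = 0" for m
    using F that bN unfolding feeder_def by metis
  have pat: "qbus x \<noteq> b \<and> ((\<exists>n. x = U n) \<or> Y $$ (qbus x, b) = 0)"
  proof (cases x)
    case (U n)
    then show ?thesis using nj grad_pattern_iff[OF F n j] by (simp del: grad_pattern.simps add: b_def)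
  next
    case (P m)
    then have "Re (Y $$ (m, b)) = 0"
      using nj grad_pattern_iff[OF F n j] n G by (simp del: grad_pattern.simps add: b_def)
    then show ?thesis using Z[of m] n P by simp
  next
    case (Q m)
    then have "Re (Y $$ (m, b)) = 0"
      using nj grad_pattern_iff[OF F n j] n G by (simp del: grad_pattern.simps add: b_def)
    then show ?thesis using Z[of m] n Q by simp
  qed
  have cur: "cur_re N Y (qbus x) ?w = cur_re N Y (qbus x) w"
    "cur_im N Y (qbus x) ?w = cur_im N Y (qbus x) w" if "Y $$ (qbus x, b) = 0"
  proof -
    have z: "Gmat Y $$ (qbus x, b) = 0" "Bmat Y $$ (qbus x, b) = 0"
      using that F n bN by (auto simp: Gmat_def Bmat_def feeder_def)
    show "cur_re N Y (qbus x) ?w = cur_re N Y (qbus x) w"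
      unfolding cur_re_def by (rule sum.cong) (use re im z in \<open>(metis atMost_iff mult_zero_right)+\<close>)
    show "cur_im N Y (qbus x) ?w = cur_im N Y (qbus x) w"
      unfolding cur_im_def by (rule sum.cong) (use re im z in \<open>(metis atMost_iff mult_zero_right)+\<close>)
  qed
  show ?thesis
    using pat cur re[OF n] im[OF n] by (cases x) (auto simp: usq_def pinj_def qinj_def)
qed

lemma ptl_jacobian_outside_pattern:
  assumes F: "feeder N L Y" and MO: "M \<union> Ob = {0..N}"
    and v: "\<And>t. t \<in> {1..T} \<Longrightarrow> v t \<in> carrier_vec (2 * (N + 1))"
    and i: "i < length (ptl_equations M Ob T)" and c: "c < 2 * (N + 1) * T"
    and nc: "(i, c) \<notin> ptl_pattern N Y M Ob T"
  shows "ptl_jacobian N Y M Ob T v $$ (i, c) = 0"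
proof -
  define e where "e = ptl_equations M Ob T ! i"
  have fin: "finite M" "finite Ob" using MO by (metis finite_Un finite_atLeastAtMost)+
  have sub: "n \<le> N" if "n \<in> M \<or> n \<in> Ob" for n using that MO by auto
  have "e \<in> set (ptl_equations M Ob T)" using i by (simp add: e_def)
  then have e: "(\<exists>t x. e = Meter t x \<and> qbus x \<le> N) \<or> (\<exists>t x. e = Couple t x \<and> qbus x \<le> N)"
    unfolding set_ptl_equations[OF fin] using sub by fastforce
  have cj: "coord N c < 2 * (N + 1)" by (simp add: coord_def)
  have "c div (2 * (N + 1)) < T" using c by (metis less_mult_imp_div_less mult.commute)
  then have st: "v (slot N c) \<in> carrier_vec (2 * (N + 1))" by (intro v) (auto simp: slot_def)
  have np: "(slot N c, coord N c) \<notin> eq_pattern N Y e"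
    using nc i c by (auto simp: ptl_pattern_def e_def)
  have "eq_lhs N Y e (v(slot N c := v (slot N c) + h \<cdot>\<^sub>v unit_vec (2 * (N + 1)) (coord N c)))
      = eq_lhs N Y e v" for h
    using e np qval_outside_pattern[OF F _ cj _ st] by auto
  then show ?thesis
    using i c by (simp add: ptl_jacobian_def partial_deriv_def e_def[symmetric])
qed

end

theory Submission
  imports Defs
begin

text \<open>A matrix with independent free entries has full generic column rank as soon as its columns
  can be matched injectively to rows through pattern positions: put ones at the matched positions
  and zeros elsewhere. In the Jacobian, the two columns of a metered bus \<open>n\<close> in slot \<open>t\<close> are
  matched to the equations of \<open>u\<^sub>n\<close> and \<open>p\<^sub>n\<close> in that slot, which leaves the equations of
  \<open>q\<^sub>n\<close> free. For a non-metered bus \<open>n\<close> the \<open>T\<close> columns of the real parts compete for the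
  \<open>T - 1\<close> coupling equations of \<open>p\<^sub>n\<close>, and likewise the imaginary parts for those of \<open>q\<^sub>n\<close>. So
  one column of each kind must be served by a metered neighbour \<open>m\<close>: if \<open>n\<close> lies in block \<open>k\<close>,
  these are the columns of slots \<open>2k - 1\<close> and \<open>2k\<close>, matched to \<open>q\<^sub>m\<close> in that slot. The slot
  determines the block and the kind of column, and within the block \<open>m\<close> determines \<open>n\<close>.\<close>

text \<open>Since \<open>f\<close> is injective, row \<open>f c\<close> has its only one in column
  \<open>c\<close>. Hence entry \<open>f c\<close> of the product with \<open>v\<close> is
  \<open>v $ c\<close>, and the kernel is trivial.\<close>

lemma rank_matching_matrix:
  fixes f :: "nat \<Rightarrow> nat"
  assumes inj: "inj_on f {..<nc}" and f: "f ` {..<nc} \<subseteq> {..<nr}"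
  shows "vec_space.rank nr (mat nr nc (\<lambda>(i, c). if i = f c then 1 else 0) :: 'a::field mat) = nc"
    (is "vec_space.rank nr ?A = nc")
proof -
  interpret vec_space "TYPE('a)" nr .
  have A: "?A \<in> carrier_mat nr nc" by simp
  have fr: "f c < nr" if "c < nc" for c using f that by blast
  have feq: "f d = f c \<longleftrightarrow> d = c" if "c < nc" "d < nc" for c d
    using inj that by (auto dest: inj_onD)
  have "c = d" if "c < nc" "d < nc" "col ?A c = col ?A d" for c d
  proof -
    have "col ?A c $ f c = 1" "col ?A d $ f c = (if f d = f c then 1 else 0)"
      using that(1,2) fr by simp_all
    with that(3) have "f d = f c" by (metis zero_neq_one)
    with that(1,2) feq show ?thesis by blast
  qed
  \<comment> \<open>Independence is a property of the set of columns, which hides repetitions, so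
    distinctness is established separately.\<close>
  then have dist: "distinct (cols ?A)" by (auto simp: distinct_conv_nth)
  have "lin_indpt (set (cols ?A))"
  proof
    assume "lin_dep (set (cols ?A))"
    from lin_depE[OF A this dist] obtain v
      where v: "v \<in> carrier_vec nc" "v \<noteq> 0\<^sub>v nc" "?A *\<^sub>v v = 0\<^sub>v nr" .
    have "v $ c = 0" if c: "c < nc" for c
    proof -
      have "0 = (?A *\<^sub>v v) $ f c" using v(3) fr[OF c] by simp
      also have "\<dots> = (\<Sum>d<nc. (if f c = f d then 1 else 0) * v $ d)"
        using v(1) fr[OF c] by (simp add: scalar_prod_def lessThan_atLeast0)
      also have "\<dots> = (\<Sum>d<nc. if d = c then v $ d else 0)"
        using feq[OF _ c] by (intro sum.cong) auto
      finally show ?thesis using c by simp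
    qed
    with v(1,2) show False by auto
  qed
  then show ?thesis by (rule lin_indpt_full_rank[OF A dist])
qed

text \<open>The 0-1 matrix of the matching belongs to the pattern class because \<open>J\<close>
  vanishes off \<open>S\<close>. It attains the upper bound on rank given by the number of
  columns.\<close>

lemma full_generic_rank_if_matching:
  assumes inj: "inj_on f {..<dim_col J}" and f: "f ` {..<dim_col J} \<subseteq> {..<dim_row J}"
    and S: "\<And>c. c < dim_col J \<Longrightarrow> (f c, c) \<in> S"
    and zero: "\<And>i c. i < dim_row J \<Longrightarrow> c < dim_col J \<Longrightarrow> (i, c) \<notin> S \<Longrightarrow> J $$ (i, c) = 0"
  shows "full_generic_rank J S"
proof -
  let ?rank = "vec_space.rank (dim_row J) :: real mat \<Rightarrow> nat"
  define A :: "real mat" where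
    "A = mat (dim_row J) (dim_col J) (\<lambda>(i, c). if i = f c then 1 else 0)"
  have A: "A \<in> pattern_class J S" using S zero by (auto simp: pattern_class_def A_def)
  have rA: "?rank A = dim_col J" unfolding A_def by (rule rank_matching_matrix[OF inj f])
  have le: "?rank B \<le> dim_col J" if "B \<in> pattern_class J S" for B
    using that by (intro vec_space.rank_le_nc) (simp add: pattern_class_def)
  have "Max (?rank ` pattern_class J S) = dim_col J"
  proof (rule Max_eqI)
    have "?rank ` pattern_class J S \<subseteq> {..dim_col J}" using le by auto
    then show "finite (?rank ` pattern_class J S)" by (rule finite_subset) simp
  qed (use A rA le in \<open>auto intro: rev_image_eqI\<close>)
  moreover have "dim_col J \<le> dim_row J" using card_inj_on_le[OF inj f] by simp
  ultimately show ?thesis by (simp add: full_generic_rank_def generic_rank_def)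
qed

text \<open>For a non-metered bus, \<open>s\<close> is the slot whose column is served by the
  neighbour \<open>g n\<close>. A slot before \<open>s\<close> uses the coupling with its successor,
  a slot after \<open>s\<close> the one with its predecessor, so no coupling is used twice.\<close>

definition matched_equation ::
    "nat \<Rightarrow> nat set \<Rightarrow> (nat \<Rightarrow> nat) \<Rightarrow> (nat \<Rightarrow> nat) \<Rightarrow> nat \<Rightarrow> nat \<Rightarrow> equation" where
  "matched_equation N M blk g t j =
    (let n = j mod (N + 1); s = (if j \<le> N then 2 * blk n - 1 else 2 * blk n) in
      if n \<in> M then Meter t (if j \<le> N then U n else P n)
      else if t = s then Meter t (Q (g n))
      else Couple (if t < s then t else t - 1) (if j \<le> N then P n else Q n))"

lemma coord_eqI:
  assumes "j < 2 * (N + 1)" "j' < 2 * (N + 1)"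
    and "j mod (N + 1) = j' mod (N + 1)" "j \<le> N \<longleftrightarrow> j' \<le> N"
  shows "j = (j' :: nat)"
  using assms by (auto simp: mod_if split: if_splits)

lemma matched_equation_inj:
  assumes t: "t \<ge> 1" "t' \<ge> 1" and j: "j < 2 * (N + 1)" "j' < 2 * (N + 1)"
    and blk: "\<And>n. n \<le> N \<Longrightarrow> n \<notin> M \<Longrightarrow> blk n \<ge> 1"
    and g: "\<And>n n'. n \<le> N \<Longrightarrow> n \<notin> M \<Longrightarrow> n' \<le> N \<Longrightarrow> n' \<notin> M \<Longrightarrow>
      blk n = blk n' \<Longrightarrow> g n = g n' \<Longrightarrow> n = n'"
    and eq: "matched_equation N M blk g t j = matched_equation N M blk g t' j'"
  shows "t = t' \<and> j = j'"
proof -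
  define n n' where "n = j mod (N + 1)" and "n' = j' mod (N + 1)"
  have n: "n \<le> N" "n' \<le> N" unfolding n_def n'_def
    using mod_less_divisor[of "N + 1"] by (simp_all add: less_Suc_eq_le)
  have "t = t' \<and> n = n' \<and> (j \<le> N \<longleftrightarrow> j' \<le> N)"
  \<comment> \<open>Columns of metered buses receive only \<open>U\<close> and \<open>P\<close>
    metering equations, the others only \<open>Q\<close> metering or coupling equations, so mixed
    pairs never collide.\<close>
  proof (cases "n \<in> M \<or> n' \<in> M")
    case True
    with eq show ?thesis
      unfolding matched_equation_def Let_def n_def[symmetric] n'_def[symmetric]
      by (auto split: if_splits)
  next
    case False
    with blk n have b: "blk n \<ge> 1" "blk n' \<ge> 1" by auto
    define s s' where "s = (if j \<le> N then 2 * blk n - 1 else 2 * blk n)"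
      and "s' = (if j' \<le> N then 2 * blk n' - 1 else 2 * blk n')"
    note E = eq[unfolded matched_equation_def Let_def, folded n_def n'_def, folded s_def s'_def]
    show ?thesis
    proof (cases "t = s")
      case True
      with E False have s: "t' = s'" "s = s'" "g n = g n'" by (auto split: if_splits)
      \<comment> \<open>The parity of \<open>s\<close> gives the kind of column. Block numbers are
        positive, so the subtraction in \<open>2 * blk n - 1\<close> does not truncate.\<close>
      have k: "(j \<le> N \<longleftrightarrow> j' \<le> N) \<and> blk n = blk n'"
        using s(2) b unfolding s_def s'_def by (auto split: if_splits; presburger)
      show ?thesis using g[of n n'] False n k s True by auto
    next
      case ne: False
      with E False have q: "t' \<noteq> s'" "n = n'" "j \<le> N \<longleftrightarrow> j' \<le> N"
        by (auto split: if_splits)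
      then have "s = s'" by (simp add: s_def s'_def)
      \<comment> \<open>The coupling index is below \<open>s\<close> exactly when
        \<open>t < s\<close>, so it determines \<open>t\<close>.\<close>
      with E False ne q t show ?thesis by (auto split: if_splits)
    qed
  qed
  then show ?thesis using coord_eqI[OF j] by (simp add: n_def n'_def)
qed

lemma matched_equation_mem:
  assumes fin: "finite M" "finite Ob" and MO: "M \<union> Ob = {0..N}" and t: "t \<in> {1..T}"
    and blk: "\<And>n. n \<in> Ob \<Longrightarrow> blk n \<ge> 1 \<and> 2 * blk n \<le> T"
    and g: "\<And>n. n \<in> Ob \<Longrightarrow> g n \<in> M"
  shows "matched_equation N M blk g t j \<in> set (ptl_equations M Ob T)"
proof -
  define n where "n = j mod (N + 1)"
  have "n \<le> N" unfolding n_def using mod_less_divisor[of "N + 1"] by (simp add: less_Suc_eq_le)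
  then have n: "n \<in> M \<or> n \<in> Ob" using MO by (metis UnE atLeastAtMost_iff le0)
  have meter: "Meter t x \<in> set (ptl_equations M Ob T)" if "qbus x \<in> M" for x
    unfolding set_ptl_equations[OF fin] using that t by (cases x) auto
  have couple: "Couple t' (P n) \<in> set (ptl_equations M Ob T)"
    "Couple t' (Q n) \<in> set (ptl_equations M Ob T)" if "n \<in> Ob" "t' \<in> {1..<T}" for t'
    unfolding set_ptl_equations[OF fin] using that by auto
  show ?thesis
  proof (cases "n \<in> M")
    case True
    then show ?thesis
      unfolding matched_equation_def Let_def n_def[symmetric] by (simp add: meter)
  next
    case False
    then have nO: "n \<in> Ob" using n by blast
    define s where "s = (if j \<le> N then 2 * blk n - 1 else 2 * blk n)"
    have "s \<in> {1..T}" using blk[OF nO] by (auto simp: s_def)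
    with t have t': "(if t < s then t else t - 1) \<in> {1..<T}" if "t \<noteq> s" using that by auto
    show ?thesis
      unfolding matched_equation_def Let_def n_def[symmetric] s_def[symmetric]
      using False meter[of "Q (g n)"] g[OF nO] couple[OF nO t'] by auto
  qed
qed

text \<open>The row of \<open>Q (g n)\<close> meets the columns of \<open>n\<close> because they are
  neighbours. The equation \<open>Couple (t - 1)\<close> also involves slot \<open>t\<close>, as
  \<open>t\<close> is at least 1.\<close>

lemma matched_equation_pattern:
  assumes F: "feeder N L Y" and MO: "M \<union> Ob = {0..N}" and t: "t \<ge> 1" and j: "j < 2 * (N + 1)"
    and g: "\<And>n. n \<in> Ob \<Longrightarrow> g n \<in> M \<and> {n, g n} \<in> L"
  shows "(t, j) \<in> eq_pattern N Y (matched_equation N M blk g t j)"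
proof -
  define n where "n = j mod (N + 1)"
  have nN: "n \<le> N" unfolding n_def using mod_less_divisor[of "N + 1"] by (simp add: less_Suc_eq_le)
  then have n: "n \<in> M \<or> n \<in> Ob" using MO by (metis UnE atLeastAtMost_iff le0)
  have G: "Gmat Y $$ (m, n) \<noteq> 0" if "m \<le> N" "m = n \<or> {m, n} \<in> L" for m
  proof -
    have "Y \<in> carrier_mat (N + 1) (N + 1)" "Re (Y $$ (m, n)) \<noteq> 0"
      using F that nN unfolding feeder_def by blast+
    with that nN show ?thesis by (simp add: Gmat_def)
  qed
  have pat: "j \<in> grad_pattern N Y x"
    if "x = U n \<or> (\<exists>m\<le>N. (m = n \<or> {m, n} \<in> L) \<and> (x = P m \<or> x = Q m))" for x
  proof -
    have "qbus x \<le> N" using that nN by auto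
    from grad_pattern_iff[OF F this j, folded n_def] show ?thesis
      using that G nN by (auto simp del: grad_pattern.simps)
  qed
  have gN: "g n \<le> N \<and> {g n, n} \<in> L" if "n \<in> Ob"
    using g[OF that] MO by (auto simp: insert_commute)
  have mem: "j \<in> grad_pattern N Y (U n)" "j \<in> grad_pattern N Y (P n)" "j \<in> grad_pattern N Y (Q n)"
    by (rule pat, use nN in blast)+
  have memg: "j \<in> grad_pattern N Y (Q (g n))" if "n \<in> Ob"
    by (rule pat) (use gN[OF that] in blast)
  show ?thesis
  proof (cases "n \<in> M")
    case True
    then show ?thesis
      unfolding matched_equation_def Let_def n_def[symmetric]
      using mem by (simp del: grad_pattern.simps)
  next
    case False
    then have "n \<in> Ob" using n by blast
    with False show ?thesis
      unfolding matched_equation_def Let_def n_def[symmetric]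
      using t mem memg by (simp del: grad_pattern.simps)
  qed
qed

theorem theorem2:
  fixes N T :: nat and L :: "nat set set" and Y :: "complex mat"
    and M Ob :: "nat set" and Obar :: "nat \<Rightarrow> nat set" and v :: "nat \<Rightarrow> real vec"
  assumes "feeder N L Y"
    and "M \<union> Ob = {0..N}" and "M \<inter> Ob = {}"
    and "T \<ge> 2" and "even T"
    and "(\<Union>k\<in>{1..nat \<lceil>real T / 2\<rceil>}. Obar k) = Ob"
    and "disjoint_family_on Obar {1..nat \<lceil>real T / 2\<rceil>}"
    and "\<And>k. k \<in> {1..nat \<lceil>real T / 2\<rceil>} \<Longrightarrow> perfectly_matched L (Obar k) M"
    and "\<And>t. t \<in> {1..T} \<Longrightarrow> v t \<in> carrier_vec (2 * (N + 1))"
  shows "full_generic_rank (ptl_jacobian N Y M Ob T v) (ptl_pattern N Y M Ob T)"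
proof -
  have fin: "finite M" "finite Ob" using assms(2) by (metis finite_Un finite_atLeastAtMost)+
  define K where "K = nat \<lceil>real T / 2\<rceil>"
  \<comment> \<open>Evenness makes the ceiling exact, so the last block also has both its slots,
    \<open>2K - 1\<close> and \<open>2K\<close>.\<close>
  have TK: "T = 2 * K" using assms(5) by (auto simp: K_def elim!: evenE)
  have "\<forall>k\<in>{1..K}. \<exists>h. inj_on h (Obar k) \<and> (\<forall>a\<in>Obar k. h a \<in> M \<and> {a, h a} \<in> L)"
    using assms(8) by (simp add: perfectly_matched_def K_def)
  then obtain h where h: "\<And>k. k \<in> {1..K} \<Longrightarrow> inj_on (h k) (Obar k)"
    "\<And>k a. k \<in> {1..K} \<Longrightarrow> a \<in> Obar k \<Longrightarrow> h k a \<in> M \<and> {a, h k a} \<in> L"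
    by metis
  have "\<forall>n\<in>Ob. \<exists>k. k \<in> {1..K} \<and> n \<in> Obar k" using assms(6) by (auto simp: K_def)
  then obtain blk where blk: "\<And>n. n \<in> Ob \<Longrightarrow> blk n \<in> {1..K} \<and> n \<in> Obar (blk n)" by metis
  define g where "g n = h (blk n) n" for n
  have g: "g n \<in> M \<and> {n, g n} \<in> L" if "n \<in> Ob" for n
    using h(2) blk[OF that] by (simp add: g_def)
  have ginj: "n = n'" if "n \<in> Ob" "n' \<in> Ob" "blk n = blk n'" "g n = g n'" for n n'
    using h(1)[of "blk n"] blk[OF that(1)] blk[OF that(2)] that(3,4)
    by (auto simp: g_def dest: inj_onD)
  have blk': "blk n \<ge> 1 \<and> 2 * blk n \<le> T" if "n \<in> Ob" for n
    using blk[OF that] TK by auto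
  have Ob: "n \<in> Ob" if "n \<le> N" "n \<notin> M" for n using that assms(2) by auto

  let ?eqs = "ptl_equations M Ob T" and ?nc = "2 * (N + 1) * T"
  let ?J = "ptl_jacobian N Y M Ob T v"
  have dim: "dim_row ?J = length ?eqs" "dim_col ?J = ?nc" by (simp_all add: ptl_jacobian_def)
  define e where "e c = matched_equation N M blk g (slot N c) (coord N c)" for c
  have st: "slot N c \<in> {1..T}" "coord N c < 2 * (N + 1)" if "c < ?nc" for c
  proof -
    have "c div (2 * (N + 1)) < T" using that by (metis less_mult_imp_div_less mult.commute)
    then show "slot N c \<in> {1..T}" by (simp add: slot_def)
  qed (simp add: coord_def)
  have "e c \<in> set ?eqs" if "c < ?nc" for c
    unfolding e_def
    by (rule matched_equation_mem[OF fin assms(2) st(1)[OF that]]) (use blk' g in blast)+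
  \<comment> \<open>\<open>f c\<close> will be a position of \<open>e c\<close> in the list;
    \<open>e c\<close> can be read off from it, so injectivity of \<open>e\<close> passes to
    \<open>f\<close>.\<close>
  then have "\<forall>c. \<exists>i. c < ?nc \<longrightarrow> i < length ?eqs \<and> ?eqs ! i = e c"
    by (metis in_set_conv_nth)
  then obtain f where f: "\<And>c. c < ?nc \<Longrightarrow> f c < length ?eqs \<and> ?eqs ! f c = e c" by metis
  have inj: "inj_on f {..<?nc}"
  proof (rule inj_onI)
    fix c d assume cd: "c \<in> {..<?nc}" "d \<in> {..<?nc}" "f c = f d"
    then have "e c = e d" using f by (metis lessThan_iff)
    then have "slot N c = slot N d \<and> coord N c = coord N d"
      unfolding e_def using st cd blk' ginj Ob
      by (intro matched_equation_inj[where blk = blk and g = g and M = M]) auto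
    then show "c = d" unfolding slot_def coord_def by (metis add_right_cancel div_mult_mod_eq)
  qed
  show ?thesis
  proof (rule full_generic_rank_if_matching[of f])
    fix c assume "c < dim_col ?J"
    then have c: "c < ?nc" by (simp add: dim)
    have "(slot N c, coord N c) \<in> eq_pattern N Y (e c)"
      unfolding e_def using st[OF c] g by (intro matched_equation_pattern[OF assms(1,2)]) auto
    then show "(f c, c) \<in> ptl_pattern N Y M Ob T"
      using f[OF c] c by (simp add: ptl_pattern_def)
  next
    fix i c assume "i < dim_row ?J" "c < dim_col ?J" "(i, c) \<notin> ptl_pattern N Y M Ob T"
    then show "?J $$ (i, c) = 0"
      using ptl_jacobian_outside_pattern[OF assms(1,2,9)] by (simp add: dim)
  qed (use inj f in \<open>auto simp: dim\<close>)
qed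

end
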